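(* Let $n\geq 1$ and $c\in\{1,\ldots,n\}$ be integers, and let $m$ and $r$ be positive integers. Write $m=kc-p$ with integers $k,p$ satisfying $0\leq p<c$. Then the containment $$I^{(m)}(n,c)\subset I^{r}(n,c)$$ holds if and only if $$r\leq \frac{(n+1)k-p}{n-c+2}.$$
   Context: Let $\mathbb{K}$ be an arbitrary field and $S(n)=\mathbb{K}[x_0,\ldots,x_n]$. Let $H_i=\{x_i=0\}\subset\mathbb{P}^n$ for $i=0,\ldots,n$. For $c\in\{1,\ldots,n\}$, $I(n,c)\subset S(n)$ denotes the ideal of the union (with reduced structure) of all $c$-fold intersections $H_{i_1}\cap\cdots\cap H_{i_c}$ with $i_1,\ldots,i_c\in\{0,\ldots,n\}$ pairwise distinct; that is, $I(n,c)$ is the intersection of the prime ideals $\langle x_{i_1},\ldots,x_{i_c}\rangle$ over all such choices of indices. For a homogeneous ideal $I\subseteq S(n)$ and a positive integer $m$, the $m$-th symbolic power is $I^{(m)}=S(n)\cap\bigcap_{Q\in\mathrm{Ass}(I)}I^m_Q$, where $I^m_Q$ is the localization of $I^m$ at $Q$ and the intersection takes place in the field of fractions of $S(n)$. Notation: $I^{(m)}(n,c)=(I(n,c))^{(m)}$ is the symbolic power and $I^r(n,c)=(I(n,c))^r$ is the ordinary power. *)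

theory Defs
  imports
    Complex_Main
    "HOL-Algebra.Ideal_Product"
    "HOL-Library.Poly_Mapping"
    "HOL-Computational_Algebra.Fraction_Field"
begin

(* Polynomials with coefficients in 'k in the variables x_0, x_1, x_2, ...: a monomial is a
   finitely supported exponent vector, a polynomial a finitely supported map from monomials to
   coefficients. *)
type_synonym 'k mpoly = "(nat \<Rightarrow>\<^sub>0 nat) \<Rightarrow>\<^sub>0 'k"

definition Var :: "nat \<Rightarrow> 'k::field mpoly" where
  "Var i = Poly_Mapping.single (Poly_Mapping.single i 1) 1"

(* S(n) = K[x_0,...,x_n], as the subring of polynomials whose monomials involve no other
   variables.  All ideals below are ideals of this ring. *)
definition poly_ring :: "nat \<Rightarrow> 'k::field mpoly ring" where
  "poly_ring n =
     \<lparr> carrier = {f. \<forall>t \<in> Poly_Mapping.keys f. Poly_Mapping.keys t \<subseteq> {0..n}},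
       mult = (*), one = 1, zero = 0, add = (+) \<rparr>"

lemma poly_ring_cring: "cring (poly_ring n :: 'k::field mpoly ring)"
proof (rule cringI)
  let ?R = "poly_ring n :: 'k mpoly ring"
  show "abelian_group ?R"
  proof (rule abelian_groupI)
    fix f g :: "'k mpoly"
    assume "f \<in> carrier ?R" "g \<in> carrier ?R"
    then show "f \<oplus>\<^bsub>?R\<^esub> g \<in> carrier ?R"
      using Poly_Mapping.keys_add[of f g] by (auto simp: poly_ring_def)
  next
    fix f :: "'k mpoly"
    assume "f \<in> carrier ?R"
    then show "\<exists>g \<in> carrier ?R. g \<oplus>\<^bsub>?R\<^esub> f = \<zero>\<^bsub>?R\<^esub>"
      by (intro bexI[of _ "- f"]) (simp_all add: poly_ring_def)
  qed (simp_all add: poly_ring_def add.assoc add.commute)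
  show "comm_monoid ?R"
  proof (rule comm_monoidI)
    fix f g :: "'k mpoly"
    assume f: "f \<in> carrier ?R" and g: "g \<in> carrier ?R"
    have "Poly_Mapping.keys t \<subseteq> {0..n}" if t: "t \<in> Poly_Mapping.keys (f * g)" for t
    proof -
      from t keys_mult[of f g] obtain a b
        where ab: "a \<in> Poly_Mapping.keys f" "b \<in> Poly_Mapping.keys g" "t = a + b" by blast
      then have "Poly_Mapping.keys a \<subseteq> {0..n}" "Poly_Mapping.keys b \<subseteq> {0..n}"
        using f g by (simp_all add: poly_ring_def)
      with ab(3) Poly_Mapping.keys_add[of a b] show ?thesis by blast
    qed
    then show "f \<otimes>\<^bsub>?R\<^esub> g \<in> carrier ?R" by (simp add: poly_ring_def)
  qed (simp_all add: poly_ring_def mult.assoc mult.commute)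
qed (simp add: poly_ring_def distrib_right)

abbreviation ideal_power :: "('a, 'b) ring_scheme \<Rightarrow> 'a set \<Rightarrow> nat \<Rightarrow> 'a set" where
  "ideal_power R I r \<equiv> I [^]\<^bsub>ideals_set R\<^esub> r"

(* Ass(I) means the associated primes of the module R/I: the prime ideals that are the annihilator
   (I : f) of the class of some element f. *)
definition associated_primes :: "('a, 'b) ring_scheme \<Rightarrow> 'a set \<Rightarrow> 'a set set" where
  "associated_primes R I =
     {Q. primeideal Q R \<and> (\<exists>f \<in> carrier R. Q = {g \<in> carrier R. g \<otimes>\<^bsub>R\<^esub> f \<in> I})}"

(* The localization J_Q of an ideal J of S(n) at a prime Q of S(n), inside a field of fractions.
   The fractions occurring have numerator and denominator in S(n), so they lie in the subfield
   Frac(S(n)) of the fraction field of the polynomials in all variables. *)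
definition localized_ideal :: "nat \<Rightarrow> 'k::field mpoly set \<Rightarrow> 'k mpoly set \<Rightarrow> 'k mpoly fract set"
  where "localized_ideal n J Q = {Fract a s | a s. a \<in> J \<and> s \<in> carrier (poly_ring n) - Q}"

(* S(n) is embedded in its field of fractions by f |-> f/1. *)
definition symbolic_power :: "nat \<Rightarrow> 'k::field mpoly set \<Rightarrow> nat \<Rightarrow> 'k mpoly set" where
  "symbolic_power n I m =
     {f \<in> carrier (poly_ring n).
        Fract f 1 \<in> (\<Inter>Q \<in> associated_primes (poly_ring n) I.
                       localized_ideal n (ideal_power (poly_ring n) I m) Q)}"

definition star_ideal :: "nat \<Rightarrow> nat \<Rightarrow> 'k::field mpoly set" where
  "star_ideal n c = (\<Inter>C \<in> {C. C \<subseteq> {0..n} \<and> card C = c}. Idl\<^bsub>poly_ring n\<^esub> (Var ` C))"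

end

theory Submission
  imports Defs
begin

text \<open>
  All ideals involved are controlled by exponent vectors. Put \<open>d = n - c + 2\<close>.
  A monomial \<open>x\<^sup>t\<close> whose partial degree in every set of \<open>c\<close> variables is at least \<open>m\<close> lies in the
  \<open>m\<close>-th symbolic power, and only such monomials occur in elements of it; the star ideal itself is
  generated by the squarefree monomials of degree \<open>d\<close>, so \<open>x\<^sup>t\<close> lies in its \<open>r\<close>-th power
  if \<open>(\<Sum>i\<le>n. min t\<^sub>i r) \<ge> r d\<close>.
  The monomial with \<open>p\<close> exponents \<open>k - 1\<close> and the others equal to \<open>k\<close> has the least degree,
  \<open>(n + 1) k - p\<close>, in the symbolic power, which gives necessity. For sufficiency, either \<open>d\<close>
  exponents are at least \<open>r\<close>, or the \<open>c\<close> smallest ones are below \<open>r\<close>; they sum to at least \<open>m\<close>, so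
  that the largest of them is at least \<open>k\<close>, as are then all remaining exponents.
\<close>

subsection \<open>Partial degrees\<close>

text \<open>For finite \<open>A\<close> this is the order of vanishing of x^t along the linear
  subspace where all x_i with i in \<open>A\<close> vanish. Taking \<open>A\<close> to be all
  variables gives the total degree.\<close>

definition part_deg :: "nat set \<Rightarrow> (nat \<Rightarrow>\<^sub>0 nat) \<Rightarrow> nat" where
  "part_deg A t = (\<Sum>i\<in>A. Poly_Mapping.lookup t i)"

lemma part_deg_add: "part_deg A (s + t) = part_deg A s + part_deg A t"
  by (simp add: part_deg_def lookup_add sum.distrib)

lemma part_deg_eq_0_iff: "finite A \<Longrightarrow> part_deg A t = 0 \<longleftrightarrow> A \<inter> Poly_Mapping.keys t = {}"
  by (auto simp: part_deg_def in_keys_iff)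

section \<open>Construction of exponent vectors and selection of terms\<close>

definition exp_vec :: "nat set \<Rightarrow> (nat \<Rightarrow> nat) \<Rightarrow> (nat \<Rightarrow>\<^sub>0 nat)" where
  "exp_vec A g = (\<Sum>i\<in>A. Poly_Mapping.single i (g i))"

lemma lookup_exp_vec: "finite A \<Longrightarrow> Poly_Mapping.lookup (exp_vec A g) i = (if i \<in> A then g i else 0)"
  by (auto simp: exp_vec_def lookup_sum lookup_single when_def)

lemma keys_exp_vec: "finite A \<Longrightarrow> Poly_Mapping.keys (exp_vec A g) = {i\<in>A. g i \<noteq> 0}"
  by (auto simp: in_keys_iff lookup_exp_vec split: if_splits)

definition restrict_terms :: "('a \<Rightarrow> bool) \<Rightarrow> ('a \<Rightarrow>\<^sub>0 'b::comm_monoid_add) \<Rightarrow> ('a \<Rightarrow>\<^sub>0 'b)" where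
  "restrict_terms P f = (\<Sum>t\<in>{t\<in>Poly_Mapping.keys f. P t}. Poly_Mapping.single t (Poly_Mapping.lookup f t))"

lemma lookup_restrict_terms: "Poly_Mapping.lookup (restrict_terms P f) t = (if P t then Poly_Mapping.lookup f t else 0)"
  by (auto simp: restrict_terms_def lookup_sum lookup_single when_def in_keys_iff)

lemma keys_restrict_terms: "Poly_Mapping.keys (restrict_terms P f) = {t\<in>Poly_Mapping.keys f. P t}"
  by (auto simp: in_keys_iff lookup_restrict_terms split: if_splits)

lemma restrict_terms_split: "f = restrict_terms P f + restrict_terms (\<lambda>t. \<not> P t) f"
  by (rule poly_mapping_eqI) (simp add: lookup_add lookup_restrict_terms)

text \<open>The lowest homogeneous part of a product is the product of the lowest homogeneous parts.\<close>

lemma part_deg_ge_of_mult: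
  fixes f s :: "'k::field mpoly"
  assumes v: "v \<in> Poly_Mapping.keys s" "part_deg A v = 0"
    and fs: "\<And>t. t \<in> Poly_Mapping.keys (f * s) \<Longrightarrow> m \<le> part_deg A t"
    and u: "u \<in> Poly_Mapping.keys f"
  shows "m \<le> part_deg A u"
proof -
  define j where "j = Min (part_deg A ` Poly_Mapping.keys f)"
  have j_le: "j \<le> part_deg A t" if "t \<in> Poly_Mapping.keys f" for t
    using that by (simp add: j_def)
  have "j \<in> part_deg A ` Poly_Mapping.keys f"
    unfolding j_def using u by (intro Min_in) auto
  then obtain u0 where u0: "u0 \<in> Poly_Mapping.keys f" "part_deg A u0 = j" by auto
  define f0 where "f0 = restrict_terms (\<lambda>t. part_deg A t = j) f"
  define f1 where "f1 = restrict_terms (\<lambda>t. part_deg A t \<noteq> j) f"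
  define s0 where "s0 = restrict_terms (\<lambda>t. part_deg A t = 0) s"
  define s1 where "s1 = restrict_terms (\<lambda>t. part_deg A t \<noteq> 0) s"
  have f: "f = f0 + f1" unfolding f0_def f1_def by (rule restrict_terms_split)
  have s: "s = s0 + s1" unfolding s0_def s1_def by (rule restrict_terms_split)
  have "u0 \<in> Poly_Mapping.keys f0" "v \<in> Poly_Mapping.keys s0"
    using u0 v by (auto simp: f0_def s0_def keys_restrict_terms)
  then have "f0 \<noteq> 0" "s0 \<noteq> 0" by auto
  then have "f0 * s0 \<noteq> 0" by simp
  then obtain t where t: "t \<in> Poly_Mapping.keys (f0 * s0)"
    by (metis all_not_in_conv keys_eq_empty)
  obtain a b where ab: "t = a + b" "a \<in> Poly_Mapping.keys f0" "b \<in> Poly_Mapping.keys s0"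
    using t keys_mult[of f0 s0] by blast
  then have tj: "part_deg A t = j"
    by (simp add: part_deg_add f0_def s0_def keys_restrict_terms)
  \<comment> \<open>All terms of \<open>f0 * s1\<close> and of \<open>f1 * s\<close> have partial
    degree above \<open>j\<close>, so they cannot cancel the term at \<open>t\<close> of
    \<open>f0 * s0\<close>.\<close>
  have "t \<notin> Poly_Mapping.keys (f0 * s1)"
  proof
    assume "t \<in> Poly_Mapping.keys (f0 * s1)"
    then obtain a b where "t = a + b" "a \<in> Poly_Mapping.keys f0" "b \<in> Poly_Mapping.keys s1"
      using keys_mult[of f0 s1] by blast
    then show False
      using tj by (simp add: part_deg_add f0_def s1_def keys_restrict_terms)
  qed
  moreover have "t \<notin> Poly_Mapping.keys (f1 * s)"
  proof
    assume "t \<in> Poly_Mapping.keys (f1 * s)"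
    then obtain a b where "t = a + b" "a \<in> Poly_Mapping.keys f1" "b \<in> Poly_Mapping.keys s"
      using keys_mult[of f1 s] by blast
    then show False
      using tj j_le[of a] by (auto simp: part_deg_add f1_def keys_restrict_terms)
  qed
  moreover have "f * s = f0 * s0 + (f0 * s1 + f1 * s)"
    by (simp add: f s algebra_simps)
  ultimately have "t \<in> Poly_Mapping.keys (f * s)"
    using t by (simp add: in_keys_iff lookup_add)
  then show ?thesis using fs tj j_le[OF u] by force
qed

subsection \<open>Ideals of the polynomial ring\<close>

lemma poly_ring_simps [simp]:
  "mult (poly_ring n) = (*)" "one (poly_ring n) = 1" "zero (poly_ring n) = 0"
  "add (poly_ring n) = (+)"
  by (simp_all add: poly_ring_def)

lemma carrier_poly_ring:
  "f \<in> carrier (poly_ring n) \<longleftrightarrow> (\<forall>t\<in>Poly_Mapping.keys f. Poly_Mapping.keys t \<subseteq> {0..n})"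
  by (simp add: poly_ring_def)

lemma monomial_in_carrier:
  "Poly_Mapping.keys t \<subseteq> {0..n} \<Longrightarrow> Poly_Mapping.single t a \<in> carrier (poly_ring n)"
  by (simp add: carrier_poly_ring)

lemma poly_ring_ideal:
  assumes "ideal J (poly_ring n)"
  shows "0 \<in> J"
    and "f \<in> J \<Longrightarrow> g \<in> J \<Longrightarrow> f + g \<in> J"
    and "f \<in> carrier (poly_ring n) \<Longrightarrow> g \<in> J \<Longrightarrow> f * g \<in> J"
  using additive_subgroup.zero_closed[OF ideal.axioms(1)[OF assms]]
    additive_subgroup.a_closed[OF ideal.axioms(1)[OF assms]]
    ideal.I_l_closed[OF assms]
  by auto

text \<open>A polynomial is the sum of its terms, and each term is a constant multiple of its
  monomial. This reduces membership to a question about exponents; the converse would need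
  \<open>J\<close> to be a monomial ideal.\<close>

lemma ideal_memI_monomials:
  assumes J: "ideal J (poly_ring n :: 'k::field mpoly ring)"
    and f: "f \<in> carrier (poly_ring n)"
    and mon: "\<And>t. t \<in> Poly_Mapping.keys f \<Longrightarrow> Poly_Mapping.single t 1 \<in> J"
  shows "f \<in> J"
proof -
  have "(\<Sum>t\<in>T. Poly_Mapping.single t (Poly_Mapping.lookup f t)) \<in> J" if "finite T" "T \<subseteq> Poly_Mapping.keys f" for T
    using that
  proof (induction T)
    case empty
    show ?case using poly_ring_ideal(1)[OF J] by simp
  next
    case (insert t T)
    have "Poly_Mapping.single 0 (Poly_Mapping.lookup f t) * Poly_Mapping.single t 1 \<in> J"
      using insert.prems mon by (intro poly_ring_ideal(3)[OF J] monomial_in_carrier) auto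
    then have "Poly_Mapping.single t (Poly_Mapping.lookup f t) \<in> J"
      by (simp add: mult_single)
    then show ?case
      using insert poly_ring_ideal(2)[OF J] by simp
  qed
  then have "restrict_terms (\<lambda>_. True) f \<in> J"
    by (simp add: restrict_terms_def)
  moreover have "restrict_terms (\<lambda>_. True) f = f"
    by (rule poly_mapping_eqI) (simp add: lookup_restrict_terms)
  ultimately show ?thesis by simp
qed

lemma monomial_multiple_in_ideal:
  assumes J: "ideal J (poly_ring n :: 'k::field mpoly ring)"
    and u: "Poly_Mapping.single u 1 \<in> J"
    and le: "\<And>i. Poly_Mapping.lookup u i \<le> Poly_Mapping.lookup t i" and t: "Poly_Mapping.keys t \<subseteq> {0..n}"
  shows "Poly_Mapping.single t 1 \<in> J"
proof -
  have eq: "(t - u) + u = t"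
    using le by (intro poly_mapping_eqI) (simp add: lookup_add lookup_minus)
  have "Poly_Mapping.keys (t - u) \<subseteq> Poly_Mapping.keys t"
    by (auto simp: in_keys_iff lookup_minus)
  then have "Poly_Mapping.single (t - u) 1 * Poly_Mapping.single u (1::'k) \<in> J"
    using t u by (intro poly_ring_ideal(3)[OF J] monomial_in_carrier) auto
  then show ?thesis by (simp add: mult_single eq)
qed

text \<open>Partial degrees add up in products, so multiplication never lowers them. With
  \<open>e = 1\<close> this describes the ideal generated by the variables of
  \<open>A\<close>.\<close>

lemma ideal_part_deg_ge:
  "ideal {f \<in> carrier (poly_ring n :: 'k::field mpoly ring). \<forall>t\<in>Poly_Mapping.keys f. e \<le> part_deg A t}
     (poly_ring n)" (is "ideal ?J ?R")
proof -
  interpret cring ?R by (rule poly_ring_cring)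
  have mult: "g * f \<in> ?J" if f: "f \<in> ?J" and g: "g \<in> carrier ?R" for f g
  proof -
    have "g * f \<in> carrier ?R" using m_closed[of g f] f g by simp
    moreover have "e \<le> part_deg A t" if t: "t \<in> Poly_Mapping.keys (g * f)" for t
    proof -
      obtain a b where "t = a + b" "b \<in> Poly_Mapping.keys f"
        using t keys_mult[of g f] by blast
      then show ?thesis using f by (force simp: part_deg_add)
    qed
    ultimately show ?thesis by simp
  qed
  show ?thesis
  proof (rule idealI)
    show "ring ?R" by (rule ring_axioms)
    show "subgroup ?J (add_monoid ?R)"
    proof (rule add.subgroupI)
      show "?J \<subseteq> carrier ?R" by blast
      have "0 \<in> ?J" by (simp add: carrier_poly_ring)
      then show "?J \<noteq> {}" by blast
      fix f g assume f: "f \<in> ?J" and g: "g \<in> ?J"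
      have "\<ominus>\<^bsub>?R\<^esub> f = - f"
        using f by (intro minus_equality) (auto simp: carrier_poly_ring)
      then show "\<ominus>\<^bsub>?R\<^esub> f \<in> ?J"
        using f by (simp add: carrier_poly_ring)
      show "f \<oplus>\<^bsub>?R\<^esub> g \<in> ?J"
        using f g keys_add[of f g] unfolding carrier_poly_ring by simp blast
    qed
    show "x \<otimes>\<^bsub>?R\<^esub> f \<in> ?J" "f \<otimes>\<^bsub>?R\<^esub> x \<in> ?J" if "f \<in> ?J" "x \<in> carrier ?R" for f x
      using mult[OF that] by (simp_all add: mult.commute)
  qed
qed

text \<open>A monomial of positive partial degree in \<open>C\<close> is divisible by some variable
  of \<open>C\<close>. The primes defining the star ideal thereby become conditions on
  exponents.\<close>

lemma genideal_Var:
  assumes C: "C \<subseteq> {0..n}"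
  shows "Idl\<^bsub>poly_ring n\<^esub> (Var ` C) =
    {f \<in> carrier (poly_ring n :: 'k::field mpoly ring). \<forall>t\<in>Poly_Mapping.keys f. 1 \<le> part_deg C t}"
    (is "?I = ?J")
proof -
  let ?R = "poly_ring n :: 'k mpoly ring"
  interpret cring ?R by (rule poly_ring_cring)
  have fin: "finite C" using C finite_subset by blast
  have "Var ` C \<subseteq> ?J"
  proof
    fix f :: "'k mpoly" assume "f \<in> Var ` C"
    then obtain i where i: "i \<in> C" "f = Var i" by blast
    then have "part_deg C (Poly_Mapping.single i 1) = 1"
      using fin by (simp add: part_deg_def lookup_single when_def)
    then show "f \<in> ?J"
      using i C by (auto simp: Var_def carrier_poly_ring)
  qed
  then have sub: "?I \<subseteq> ?J" by (intro genideal_minimal ideal_part_deg_ge)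
  have VC: "Var ` C \<subseteq> carrier ?R"
    using \<open>Var ` C \<subseteq> ?J\<close> by blast
  have I: "ideal ?I ?R" using VC by (rule genideal_ideal)
  have "?J \<subseteq> ?I"
  proof
    fix f assume f: "f \<in> ?J"
    show "f \<in> ?I"
    proof (rule ideal_memI_monomials[OF I])
      show "f \<in> carrier ?R" using f by simp
      fix t assume t: "t \<in> Poly_Mapping.keys f"
      then have "part_deg C t \<noteq> 0" using f by force
      then have "C \<inter> Poly_Mapping.keys t \<noteq> {}"
        by (simp only: part_deg_eq_0_iff[OF fin] not_False_eq_True)
      then obtain i where i: "i \<in> C" "i \<in> Poly_Mapping.keys t" by auto
      have Var: "Poly_Mapping.single (Poly_Mapping.single i 1) 1 \<in> ?I"
        using subsetD[OF genideal_self[OF VC] imageI[OF i(1)]] by (simp only: Var_def)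
      show "Poly_Mapping.single t 1 \<in> ?I"
      proof (rule monomial_multiple_in_ideal[OF I Var])
        show "Poly_Mapping.lookup (Poly_Mapping.single i 1) j \<le> Poly_Mapping.lookup t j" for j
          using i by (auto simp: lookup_single when_def in_keys_iff)
        show "Poly_Mapping.keys t \<subseteq> {0..n}"
          using f t by (simp add: carrier_poly_ring)
      qed
    qed
  qed
  with sub show ?thesis by blast
qed

section \<open>Ordinary powers of ideals\<close>

lemma ideal_power_0: "ideal_power R I 0 = carrier R"
  by (simp add: nat_pow_def ideals_set_def)

lemma ideal_power_Suc: "ideal_power R I (Suc r) = ideal_prod R (ideal_power R I r) I"
  by (simp add: nat_pow_def ideals_set_def)

lemma (in ring) ideal_ideal_power: "ideal I R \<Longrightarrow> ideal (ideal_power R I r) R"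
  by (induction r) (simp_all only: ideal_power_0 ideal_power_Suc oneideal ideal_prod_is_ideal)

text \<open>Each factor from \<open>I\<close> contributes at least \<open>e\<close>, and sums create
  no new exponents. It serves twice: with \<open>e = 1\<close> and \<open>c\<close> variables for
  symbolic powers, and with all variables and \<open>e = n + 2 - c\<close> for necessity.\<close>

lemma ideal_power_part_deg_ge:
  assumes I: "\<And>f t. f \<in> I \<Longrightarrow> t \<in> Poly_Mapping.keys f \<Longrightarrow> e \<le> part_deg A t"
  shows "f \<in> ideal_power (poly_ring n :: 'k::field mpoly ring) I r \<Longrightarrow> t \<in> Poly_Mapping.keys f
    \<Longrightarrow> r * e \<le> part_deg A t"
proof (induction r arbitrary: f t)
  case 0
  then show ?case by simp
next
  case (Suc r)
  from Suc.prems(1) have "\<forall>t\<in>Poly_Mapping.keys f. Suc r * e \<le> part_deg A t"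
    unfolding ideal_power_Suc
  proof (induction f rule: ideal_prod.induct)
    case (prod f g)
    show ?case
    proof
      fix t assume "t \<in> Poly_Mapping.keys (f \<otimes>\<^bsub>poly_ring n\<^esub> g)"
      then obtain a b where "t = a + b" "a \<in> Poly_Mapping.keys f" "b \<in> Poly_Mapping.keys g"
        using keys_mult[of f g] by auto
      then show "Suc r * e \<le> part_deg A t"
        using add_mono[OF I[OF prod(2) \<open>b \<in> _\<close>] Suc.IH[OF prod(1) \<open>a \<in> _\<close>]] \<open>t = a + b\<close> by (simp add: part_deg_add add.commute[of "part_deg A a"])
    qed
  next
    case (sum f g)
    then show ?case using keys_add[of f g] by auto
  qed
  then show ?case using Suc.prems(2) by blast
qed

subsection \<open>The star ideal\<close>

lemma star_ideal_iff:
  assumes "c \<le> n"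
  shows "f \<in> star_ideal n c \<longleftrightarrow> f \<in> carrier (poly_ring n :: 'k::field mpoly ring) \<and>
    (\<forall>t\<in>Poly_Mapping.keys f. \<forall>C. C \<subseteq> {0..n} \<and> card C = c \<longrightarrow> 1 \<le> part_deg C t)"
proof -
  \<comment> \<open>The index family must be nonempty: an empty intersection would be
    \<open>UNIV\<close> and not lie in the carrier.\<close>
  obtain C where "C \<subseteq> {0..n}" "card C = c"
    using obtain_subset_with_card_n[of c "{0..n}"] assms by auto
  then show ?thesis
    by (auto simp: star_ideal_def genideal_Var)
qed

lemma ideal_star_ideal:
  assumes "c \<le> n"
  shows "ideal (star_ideal n c) (poly_ring n :: 'k::field mpoly ring)"
proof -
  interpret cring "poly_ring n :: 'k mpoly ring" by (rule poly_ring_cring)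
  obtain C where C: "C \<subseteq> {0..n}" "card C = c"
    using obtain_subset_with_card_n[of c "{0..n}"] assms by auto
  show ?thesis
    unfolding star_ideal_def
  proof (rule i_Intersect)
    show "(\<lambda>C. Idl\<^bsub>poly_ring n\<^esub> (Var ` C)) ` {C. C \<subseteq> {0..n} \<and> card C = c} \<noteq> {}"
      using C by blast
  qed (auto simp: genideal_Var ideal_part_deg_ge)
qed

text \<open>The support of such a monomial meets every set of \<open>c\<close> indices, so at most
  \<open>c - 1\<close> of the \<open>n + 1\<close> variables are missing from it.\<close>

lemma star_ideal_part_deg:
  assumes c: "c \<le> n" and f: "f \<in> star_ideal n c" and t: "t \<in> Poly_Mapping.keys (f :: 'k::field mpoly)"
  shows "n + 2 - c \<le> part_deg {0..n} t"
proof (rule ccontr)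
  assume "\<not> ?thesis"
  moreover have "card ({0..n} \<inter> Poly_Mapping.keys t) \<le> part_deg {0..n} t"
  proof -
    have "card ({0..n} \<inter> Poly_Mapping.keys t) = (\<Sum>i\<in>{0..n} \<inter> Poly_Mapping.keys t. 1)" by simp
    also have "\<dots> \<le> (\<Sum>i\<in>{0..n} \<inter> Poly_Mapping.keys t. Poly_Mapping.lookup t i)"
      by (rule sum_mono) (auto simp: in_keys_iff)
    also have "\<dots> \<le> part_deg {0..n} t"
      unfolding part_deg_def by (rule sum_mono2) auto
    finally show ?thesis .
  qed
  ultimately have "card ({0..n} \<inter> Poly_Mapping.keys t) < n + 2 - c" by simp
  moreover have "card ({0..n} - Poly_Mapping.keys t) = n + 1 - card ({0..n} \<inter> Poly_Mapping.keys t)"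
    by (subst card_Diff_subset_Int) auto
  ultimately have "c \<le> card ({0..n} - Poly_Mapping.keys t)" using c by simp
  then obtain C where C: "C \<subseteq> {0..n} - Poly_Mapping.keys t" "card C = c" "finite C"
    using obtain_subset_with_card_n by metis
  then have "part_deg C t = 0" by (subst part_deg_eq_0_iff) auto
  moreover have "1 \<le> part_deg C t"
    using C f t star_ideal_iff[OF c] by (metis Diff_subset subset_trans)
  ultimately show False by simp
qed

text \<open>By pigeonhole, sets of sizes \<open>c\<close> and \<open>n + 2 - c\<close> cannot be
  disjoint among \<open>n + 1\<close> indices.\<close>

lemma squarefree_in_star_ideal:
  assumes c: "c \<le> n" and D: "D \<subseteq> {0..n}" "card D = n + 2 - c"
  shows "Poly_Mapping.single (exp_vec D (\<lambda>_. 1)) 1 \<in> (star_ideal n c :: 'k::field mpoly set)"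
proof -
  have fin: "finite D" using D finite_subset by blast
  have "1 \<le> part_deg C (exp_vec D (\<lambda>_. 1))" if C: "C \<subseteq> {0..n}" "card C = c" for C
  proof (rule ccontr)
    have finC: "finite C" using C finite_subset by blast
    assume "\<not> ?thesis"
    then have "C \<inter> D = {}"
      using part_deg_eq_0_iff[OF finC, of "exp_vec D (\<lambda>_. 1)"] by (auto simp: keys_exp_vec fin)
    then have "card (C \<union> D) = n + 2"
      using C D c fin finC by (simp add: card_Un_disjoint)
    moreover have "card (C \<union> D) \<le> card {0..n}"
      using C D by (intro card_mono) auto
    ultimately show False by simp
  qed
  then show ?thesis
    using D by (auto simp: star_ideal_iff[OF c] carrier_poly_ring keys_exp_vec fin)
qed

text \<open>Induction on \<open>r\<close> splits off one squarefree generator at a time. Exponents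
  are truncated at \<open>r\<close> because each variable occurs at most once in each of the
  \<open>r\<close> squarefree factors.\<close>

lemma monomial_in_star_ideal_power:
  assumes c: "c \<le> n"
  shows "Poly_Mapping.keys t \<subseteq> {0..n} \<Longrightarrow> r * (n + 2 - c) \<le> (\<Sum>i\<in>{0..n}. min (Poly_Mapping.lookup t i) r) \<Longrightarrow>
    Poly_Mapping.single t 1 \<in> ideal_power (poly_ring n) (star_ideal n c :: 'k::field mpoly set) r"
proof (induction r arbitrary: t)
  case 0
  then show ?case by (simp only: ideal_power_0 monomial_in_carrier)
next
  case (Suc r)
  let ?R = "poly_ring n :: 'k mpoly ring"
  let ?d = "n + 2 - c"
  interpret cring ?R by (rule poly_ring_cring)
  \<comment> \<open>\<open>B\<close> collects the indices whose truncated exponent drops by one when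
    the bound falls from \<open>Suc r\<close> to \<open>r\<close>, whether or not the variable is
    divided out. Hence the generator should use all of \<open>B\<close> if possible.\<close>
  define B where "B = {i\<in>{0..n}. Suc r \<le> Poly_Mapping.lookup t i}"
  define S where "S = {i\<in>{0..n}. 0 < Poly_Mapping.lookup t i}"
  have fin: "finite B" "finite S" and BS: "B \<subseteq> S" by (auto simp: B_def S_def)
  \<comment> \<open>Each summand is at most \<open>Suc r\<close>, so enough variables occur in x^t
    to form a squarefree generator.\<close>
  have "Suc r * ?d \<le> (\<Sum>i\<in>S. min (Poly_Mapping.lookup t i) (Suc r))"
    using Suc.prems(2) unfolding S_def
    by (subst sum.mono_neutral_cong_left[where T="{0..n}" and h="\<lambda>i. min (Poly_Mapping.lookup t i) (Suc r)"]) auto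
  also have "\<dots> \<le> (\<Sum>i\<in>S. Suc r)" by (rule sum_mono) simp
  finally have "Suc r * ?d \<le> Suc r * card S" by (simp add: mult.commute)
  then have cardS: "?d \<le> card S" by (simp only: Suc_mult_le_cancel1)
  obtain D where D: "D \<subseteq> S" "card D = ?d" and BD: "D \<subseteq> B \<or> B \<subseteq> D"
  proof (cases "?d \<le> card B")
    case True
    then obtain D where "D \<subseteq> B" "card D = ?d" using obtain_subset_with_card_n by metis
    with BS that show ?thesis by blast
  next
    case False
    then have "card B \<le> ?d" by simp
    then obtain D where "B \<subseteq> D" "D \<subseteq> S" "card D = ?d"
      using exists_subset_between[OF _ cardS BS fin(2)] by metis
    with that show ?thesis by blast
  qed
  have finD: "finite D" and Dn: "D \<subseteq> {0..n}"
    using finite_subset[OF D(1) fin(2)] D(1) by (auto simp: S_def)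
  define t' where "t' = t - exp_vec D (\<lambda>_. 1)"
  have t': "Poly_Mapping.lookup t' i = (if i \<in> D then Poly_Mapping.lookup t i - 1 else Poly_Mapping.lookup t i)" for i
    by (simp add: t'_def lookup_minus lookup_exp_vec finD)
  have keys_t': "Poly_Mapping.keys t' \<subseteq> {0..n}"
    using Suc.prems(1) by (auto simp: in_keys_iff t' split: if_splits)
  have "r * ?d \<le> (\<Sum>i\<in>{0..n}. min (Poly_Mapping.lookup t' i) r)"
    using BD
  proof
    \<comment> \<open>The indices in \<open>D\<close> keep exponents at least \<open>r\<close> after
      the division, so they alone supply \<open>r * ?d\<close>.\<close>
    assume "D \<subseteq> B"
    then have "r * ?d = (\<Sum>i\<in>D. min (Poly_Mapping.lookup t' i) r)"
      using D(2) by (subst sum.cong[OF refl, where h="\<lambda>_. r"]) (auto simp: t' B_def)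
    also have "\<dots> \<le> (\<Sum>i\<in>{0..n}. min (Poly_Mapping.lookup t' i) r)"
      using Dn by (intro sum_mono2) auto
    finally show ?thesis .
  next
    assume "B \<subseteq> D"
    \<comment> \<open>Here the truncated sum drops by exactly \<open>card D\<close>, that is by
      \<open>?d\<close>.\<close>
    have "min (Poly_Mapping.lookup t i) (Suc r) = min (Poly_Mapping.lookup t' i) r + (if i \<in> D then 1 else 0)"
      if "i \<in> {0..n}" for i
      using \<open>B \<subseteq> D\<close> D(1) that by (cases "Poly_Mapping.lookup t i") (auto simp: t' B_def S_def)
    then have "(\<Sum>i\<in>{0..n}. min (Poly_Mapping.lookup t i) (Suc r)) =
        (\<Sum>i\<in>{0..n}. min (Poly_Mapping.lookup t' i) r + (if i \<in> D then 1 else 0))"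
      by (intro sum.cong) auto
    also have "\<dots> = (\<Sum>i\<in>{0..n}. min (Poly_Mapping.lookup t' i) r) + card ({0..n} \<inter> D)"
      by (simp add: sum.distrib sum.If_cases)
    also have "{0..n} \<inter> D = D" using Dn by blast
    finally show ?thesis using Suc.prems(2) D(2) by simp
  qed
  then have "Poly_Mapping.single t' 1 \<in> ideal_power ?R (star_ideal n c) r"
    using Suc.IH keys_t' by blast
  from ideal_prod.prod[OF this squarefree_in_star_ideal[OF c Dn D(2)], of ?R]
  have "Poly_Mapping.single (t' + exp_vec D (\<lambda>_. 1)) 1 \<in> ideal_power ?R (star_ideal n c) (Suc r)"
    by (simp only: ideal_power_Suc mult_single poly_ring_simps mult_1)
  moreover have "t' + exp_vec D (\<lambda>_. 1) = t"
    using D(1) by (intro poly_mapping_eqI) (auto simp: lookup_add t' lookup_exp_vec finD S_def)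
  ultimately show ?case by simp
qed

subsection \<open>Symbolic powers of the star ideal\<close>

text \<open>\<open>0 \<in> Q\<close> keeps the denominators nonzero, away from the default value of
  \<open>Fract\<close>; equality of fractions is then cross-multiplication.\<close>

lemma Fract_1_in_localized_ideal_iff:
  assumes "0 \<in> Q"
  shows "Fract f 1 \<in> localized_ideal n J Q \<longleftrightarrow>
    (\<exists>s \<in> carrier (poly_ring n) - Q. f * s \<in> (J :: 'k::field mpoly set))"
proof
  assume "Fract f 1 \<in> localized_ideal n J Q"
  then obtain a s where as: "Fract f 1 = Fract a s" "a \<in> J" "s \<in> carrier (poly_ring n) - Q"
    by (auto simp: localized_ideal_def)
  then have "s \<noteq> 0" using assms by auto
  with as have "f * s = a" by (simp add: eq_fract)
  with as show "\<exists>s \<in> carrier (poly_ring n) - Q. f * s \<in> J" by blast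
next
  assume "\<exists>s \<in> carrier (poly_ring n) - Q. f * s \<in> J"
  then obtain s where s: "s \<in> carrier (poly_ring n) - Q" "f * s \<in> J" by blast
  then have "s \<noteq> 0" using assms by auto
  then have "Fract f 1 = Fract (f * s) s" by (simp add: eq_fract)
  with s show "Fract f 1 \<in> localized_ideal n J Q"
    unfolding localized_ideal_def by blast
qed

text \<open>The prime is the annihilator of the class of the product of all variables outside
  \<open>C\<close>: that product already meets every \<open>c\<close>-set other than
  \<open>C\<close>, so only the condition for \<open>C\<close> remains.\<close>

lemma associated_prime_star_ideal:
  assumes c: "1 \<le> c" "c \<le> n" and C: "C \<subseteq> {0..n}" "card C = c"
  shows "Idl\<^bsub>poly_ring n\<^esub> (Var ` C)
    \<in> associated_primes (poly_ring n :: 'k::field mpoly ring) (star_ideal n c)"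
proof -
  let ?R = "poly_ring n :: 'k mpoly ring"
  let ?P = "{f \<in> carrier ?R. \<forall>t\<in>Poly_Mapping.keys f. 1 \<le> part_deg C t}"
  interpret cring ?R by (rule poly_ring_cring)
  have fin: "finite C" using C finite_subset by blast
  \<comment> \<open>A term of \<open>g\<close> free of the variables in \<open>C\<close> forces the
    partial degree onto \<open>f\<close>. This yields primality and also one inclusion of the
    annihilator.\<close>
  have cancel: "f \<in> ?P"
    if f: "f \<in> carrier ?R" and g: "g \<in> carrier ?R" "g \<notin> ?P" and fg: "f * g \<in> ?P" for f g
  proof -
    obtain v where "v \<in> Poly_Mapping.keys g" "part_deg C v = 0" using g by fastforce
    then have "1 \<le> part_deg C u" if "u \<in> Poly_Mapping.keys f" for u
      using part_deg_ge_of_mult[of v g C f 1 u] fg that by simp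
    with f show ?thesis by simp
  qed
  have prime: "primeideal ?P ?R"
  proof (rule primeidealI)
    have "1 \<notin> ?P" by (simp add: part_deg_def)
    moreover have "1 \<in> carrier ?R" by (simp add: carrier_poly_ring)
    ultimately show "carrier ?R \<noteq> ?P" by blast
    show "a \<in> ?P \<or> b \<in> ?P"
      if "a \<in> carrier ?R" "b \<in> carrier ?R" "a \<otimes>\<^bsub>?R\<^esub> b \<in> ?P" for a b
      using cancel[of a b] that by auto
  qed (rule ideal_part_deg_ge, rule poly_ring_cring)
  let ?u = "exp_vec ({0..n} - C) (\<lambda>_. 1)"
  let ?f = "Poly_Mapping.single ?u (1::'k)"
  have keys_u: "Poly_Mapping.keys ?u = {0..n} - C" by (auto simp: keys_exp_vec)
  then have f: "?f \<in> carrier ?R" by (simp add: monomial_in_carrier)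
  have "?P = {g \<in> carrier ?R. g \<otimes>\<^bsub>?R\<^esub> ?f \<in> star_ideal n c}"
  proof (intro equalityI subsetI)
    fix g assume g: "g \<in> ?P"
    have "1 \<le> part_deg C' t"
      if t: "t \<in> Poly_Mapping.keys (g * ?f)" and C': "C' \<subseteq> {0..n}" "card C' = c" for t C'
    proof -
      obtain a where a: "a \<in> Poly_Mapping.keys g" "t = a + ?u"
        using t keys_mult[of g ?f] by auto
      show ?thesis
      proof (cases "C' = C")
        case True
        with a g show ?thesis by (force simp: part_deg_add)
      next
        case False
        have finC': "finite C'" using C' finite_subset by blast
        have "\<not> C' \<subseteq> C" using False C C' fin card_subset_eq by metis
        then have "C' \<inter> Poly_Mapping.keys ?u \<noteq> {}" unfolding keys_u using C' by blast
        then have "part_deg C' ?u \<noteq> 0" using part_deg_eq_0_iff[OF finC', of ?u] by blast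
        with a show ?thesis by (simp add: part_deg_add)
      qed
    qed
    moreover have "g * ?f \<in> carrier ?R" using m_closed[of g ?f] f g by simp
    ultimately show "g \<in> {g \<in> carrier ?R. g \<otimes>\<^bsub>?R\<^esub> ?f \<in> star_ideal n c}"
      using g by (simp add: star_ideal_iff[OF c(2)])
  next
    fix g assume g: "g \<in> {g \<in> carrier ?R. g \<otimes>\<^bsub>?R\<^esub> ?f \<in> star_ideal n c}"
    have "part_deg C ?u = 0" using keys_u by (subst part_deg_eq_0_iff[OF fin]) blast
    then have "?f \<notin> ?P" by simp
    moreover have "g * ?f \<in> ?P"
      using g C by (auto simp: star_ideal_iff[OF c(2)])
    ultimately show "g \<in> ?P" using cancel f g by blast
  qed
  with prime f show ?thesis
    by (auto simp: associated_primes_def genideal_Var[OF C(1)])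
qed

text \<open>Localizing at the prime of \<open>C\<close> gives \<open>f * s\<close> in the ordinary
  power, where \<open>s\<close> has a term free of the variables in \<open>C\<close>. The partial
  degree \<open>m\<close> must then come from \<open>f\<close>.\<close>

lemma symbolic_power_part_deg:
  assumes c: "1 \<le> c" "c \<le> n" and C: "C \<subseteq> {0..n}" "card C = c"
    and f: "f \<in> symbolic_power n (star_ideal n c :: 'k::field mpoly set) m" and t: "t \<in> Poly_Mapping.keys f"
  shows "m \<le> part_deg C t"
proof -
  let ?R = "poly_ring n :: 'k mpoly ring"
  let ?P = "{f \<in> carrier ?R. \<forall>t\<in>Poly_Mapping.keys f. 1 \<le> part_deg C t}"
  have "Fract f 1 \<in> localized_ideal n (ideal_power ?R (star_ideal n c) m) ?P"
    using f associated_prime_star_ideal[OF c C, where 'k='k]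
    by (simp add: symbolic_power_def genideal_Var[OF C(1)])
  moreover have "0 \<in> ?P" by (simp add: carrier_poly_ring)
  ultimately have "\<exists>s \<in> carrier ?R - ?P. f * s \<in> ideal_power ?R (star_ideal n c) m"
    by (simp only: Fract_1_in_localized_ideal_iff)
  then obtain s where s: "s \<in> carrier ?R - ?P" "f * s \<in> ideal_power ?R (star_ideal n c) m" ..
  then have "\<exists>v\<in>Poly_Mapping.keys s. \<not> 1 \<le> part_deg C v" by blast
  then obtain v where v: "v \<in> Poly_Mapping.keys s" "part_deg C v = 0" by auto
  have "m * 1 \<le> part_deg C t" if "t \<in> Poly_Mapping.keys (f * s)" for t
    using s(2) that
    by (rule ideal_power_part_deg_ge[rotated]) (use C in \<open>auto simp: star_ideal_iff[OF c(2)]\<close>)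
  then show ?thesis using part_deg_ge_of_mult[OF v _ t, of m] by simp
qed

text \<open>Every associated prime lies in the ideal of some \<open>c\<close> variables, so the product of the \<open>m\<close>-th
  powers of the other variables is an admissible denominator. This avoids determining all
  associated primes.\<close>

lemma monomial_in_symbolic_power:
  assumes c: "1 \<le> c" "c \<le> n" and t: "Poly_Mapping.keys t \<subseteq> {0..n}"
    and ge: "\<And>C. C \<subseteq> {0..n} \<Longrightarrow> card C = c \<Longrightarrow> m \<le> part_deg C t"
  shows "Poly_Mapping.single t 1 \<in> symbolic_power n (star_ideal n c :: 'k::field mpoly set) m"
proof -
  let ?R = "poly_ring n :: 'k mpoly ring"
  let ?I = "star_ideal n c :: 'k mpoly set"
  have "Fract (Poly_Mapping.single t 1) 1 \<in> localized_ideal n (ideal_power ?R ?I m) Q"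
    if Q: "Q \<in> associated_primes ?R ?I" for Q
  proof -
    obtain f where prime: "primeideal Q ?R" and f: "f \<in> carrier ?R"
      and Qf: "Q = {g \<in> carrier ?R. g * f \<in> ?I}"
      using Q by (auto simp: associated_primes_def)
    have Qid: "ideal Q ?R" using prime by (rule primeideal.axioms)
    have "f \<notin> ?I"
    proof
      assume "f \<in> ?I"
      then have "Q = carrier ?R"
        using poly_ring_ideal(3)[OF ideal_star_ideal[OF c(2)]] Qf by auto
      then show False using primeideal.I_notcarr[OF prime] by simp
    qed
    then obtain C v where C: "C \<subseteq> {0..n}" "card C = c"
      and "v \<in> Poly_Mapping.keys f" "\<not> 1 \<le> part_deg C v"
      using f unfolding star_ideal_iff[OF c(2)] by blast
    then have v: "v \<in> Poly_Mapping.keys f" "part_deg C v = 0" by auto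
    have fin: "finite C" using C finite_subset by blast
    let ?u = "exp_vec ({0..n} - C) (\<lambda>_. m)"
    have keys_u: "Poly_Mapping.keys ?u \<subseteq> {0..n} - C" by (auto simp: keys_exp_vec)
    have u0: "part_deg C ?u = 0" using keys_u by (subst part_deg_eq_0_iff[OF fin]) auto
    let ?s = "Poly_Mapping.single ?u (1::'k)"
    have s: "?s \<in> carrier ?R" using keys_u by (intro monomial_in_carrier) auto
    \<comment> \<open>Otherwise \<open>?s * f\<close> would lie in the star ideal. As
      \<open>f\<close> has a term free of the variables in \<open>C\<close>, the partial degree
      would have to come from \<open>?s\<close>, where it is zero.\<close>
    have "?s \<notin> Q"
    proof
      assume "?s \<in> Q"
      then have "?s * f \<in> ?I" using Qf by simp
      then have "1 \<le> part_deg C w" if "w \<in> Poly_Mapping.keys (?s * f)" for w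
        using C that star_ideal_iff[OF c(2)] by blast
      then have "1 \<le> part_deg C ?u"
        using part_deg_ge_of_mult[OF v, of ?s 1 ?u] by simp
      with u0 show False by simp
    qed
    moreover have "Poly_Mapping.single (t + ?u) 1 \<in> ideal_power ?R ?I m"
    proof (rule monomial_in_star_ideal_power[OF c(2)])
      show "Poly_Mapping.keys (t + ?u) \<subseteq> {0..n}"
        using keys_add[of t ?u] t keys_u by blast
      let ?g = "\<lambda>i. min (Poly_Mapping.lookup (t + ?u) i) m"
      \<comment> \<open>The \<open>n + 1 - c\<close> indices outside \<open>C\<close> contribute
        exactly \<open>m\<close> each, so a further \<open>m\<close> from \<open>C\<close> reaches
        the bound \<open>m * (n + 2 - c)\<close>.\<close>
      have "m \<le> (\<Sum>i\<in>C. ?g i)"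
      proof (cases "\<exists>i\<in>C. m \<le> Poly_Mapping.lookup t i")
        case True
        then obtain i where i: "i \<in> C" "m \<le> Poly_Mapping.lookup t i" by blast
        then have "m \<le> ?g i" by (simp add: lookup_add)
        also have "\<dots> \<le> (\<Sum>i\<in>C. ?g i)" using i fin by (intro member_le_sum) auto
        finally show ?thesis .
      next
        case False
        then have "(\<Sum>i\<in>C. ?g i) = part_deg C t"
          unfolding part_deg_def by (intro sum.cong) (auto simp: lookup_add lookup_exp_vec)
        then show ?thesis using ge[OF C] by simp
      qed
      moreover have "(\<Sum>i\<in>{0..n} - C. ?g i) = (\<Sum>i\<in>{0..n} - C. m)"
        by (rule sum.cong) (auto simp: lookup_add lookup_exp_vec)
      then have "(\<Sum>i\<in>{0..n} - C. ?g i) = (n + 1 - c) * m"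
        using C fin by (simp add: card_Diff_subset)
      moreover have "(\<Sum>i\<in>{0..n}. ?g i) = (\<Sum>i\<in>{0..n} - C. ?g i) + (\<Sum>i\<in>C. ?g i)"
        using C by (intro sum.subset_diff) auto
      moreover have "m * (n + 2 - c) = (n + 1 - c) * m + m"
        using c by (simp add: Suc_diff_le algebra_simps)
      ultimately show "m * (n + 2 - c) \<le> (\<Sum>i\<in>{0..n}. ?g i)" by linarith
    qed
    then have "Poly_Mapping.single t 1 * ?s \<in> ideal_power ?R ?I m"
      by (simp add: mult_single)
    ultimately show ?thesis
      unfolding Fract_1_in_localized_ideal_iff[OF poly_ring_ideal(1)[OF Qid]] using s by blast
  qed
  then show ?thesis
    using t by (simp add: symbolic_power_def monomial_in_carrier)
qed

subsection \<open>Comparison of exponents\<close>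

text \<open>Greedy choice: adjoin a minimizer of \<open>g\<close> on the complement,
  \<open>c\<close> times.\<close>

lemma obtain_smallest_subset:
  fixes g :: "'a \<Rightarrow> 'b::linorder"
  assumes "finite A" "c \<le> card A"
  obtains C where "C \<subseteq> A" "card C = c" "\<And>i j. i \<in> C \<Longrightarrow> j \<in> A - C \<Longrightarrow> g i \<le> g j"
proof -
  have "\<exists>C\<subseteq>A. card C = c \<and> (\<forall>i\<in>C. \<forall>j\<in>A - C. g i \<le> g j)"
    using assms(2)
  proof (induction c)
    case 0
    show ?case by (rule exI[of _ "{}"]) simp
  next
    case (Suc c)
    then obtain C where C: "C \<subseteq> A" "card C = c" "\<forall>i\<in>C. \<forall>j\<in>A - C. g i \<le> g j" by auto
    have fin: "finite C" using C assms(1) finite_subset by blast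
    have "A - C \<noteq> {}"
    proof
      assume "A - C = {}"
      then have "A = C" using C by blast
      then show False using C Suc.prems by simp
    qed
    then obtain x where x: "x \<in> A - C" "\<forall>j\<in>A - C. g x \<le> g j"
      using ex_min_if_finite[of "g ` (A - C)"] assms(1)
      by (metis (no_types, lifting) arg_min_if_finite(1) arg_min_least finite_Diff)
    show ?case
      using C x fin by (intro exI[of _ "insert x C"]) auto
  qed
  with that show thesis by blast
qed

text \<open>The hypothesis \<open>c * k < m + c\<close> says that \<open>k\<close> is at most m/c
  rounded up, so \<open>c\<close> numbers with sum at least \<open>m\<close> cannot all be below
  \<open>k\<close>. Applied to the \<open>c\<close> smallest values, this bounds all the others from
  below.\<close>

lemma sum_min_ge:
  fixes g :: "nat \<Rightarrow> nat"
  assumes c: "1 \<le> c" "c \<le> n"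
    and ge: "\<And>C. C \<subseteq> {0..n} \<Longrightarrow> card C = c \<Longrightarrow> m \<le> (\<Sum>i\<in>C. g i)"
    and k: "c * k < m + c" and r: "r * (n + 2 - c) \<le> m + (n + 1 - c) * k"
  shows "r * (n + 2 - c) \<le> (\<Sum>i\<in>{0..n}. min (g i) r)"
proof -
  obtain C where C: "C \<subseteq> {0..n}" "card C = c"
    and small: "\<And>i j. i \<in> C \<Longrightarrow> j \<in> {0..n} - C \<Longrightarrow> g i \<le> g j"
    using obtain_smallest_subset[of "{0..n}" c g] c by auto
  have fin: "finite C" using C finite_subset by blast
  have card: "card ({0..n} - C) = n + 1 - c" using C fin by (simp add: card_Diff_subset)
  have m: "m \<le> (\<Sum>i\<in>C. g i)" using ge C by blast
  have "\<exists>x\<in>C. k \<le> g x"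
  proof (rule ccontr)
    assume "\<not> ?thesis"
    then have "(\<Sum>i\<in>C. g i + 1) \<le> (\<Sum>i\<in>C. k)" by (intro sum_mono) force
    moreover have "(\<Sum>i\<in>C. g i + 1) = (\<Sum>i\<in>C. g i) + c"
      unfolding sum.distrib using C by simp
    ultimately show False using k m C by simp
  qed
  then obtain x where x: "x \<in> C" "k \<le> g x" by blast
  have split: "(\<Sum>i\<in>{0..n}. min (g i) r) =
      (\<Sum>i\<in>{0..n} - C. min (g i) r) + (\<Sum>i\<in>C. min (g i) r)"
    using C by (intro sum.subset_diff) auto
  show ?thesis
  proof (cases "\<exists>y\<in>C. r \<le> g y")
    case True
    then obtain y where y: "y \<in> C" "r \<le> g y" by blast
    \<comment> \<open>Everything outside \<open>C\<close> is at least \<open>g y\<close>, hence at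
      least \<open>r\<close>; together with \<open>y\<close> this makes \<open>n + 2 - c\<close>
      full summands.\<close>
    have "(\<Sum>i\<in>{0..n} - C. min (g i) r) = (\<Sum>i\<in>{0..n} - C. r)"
      by (rule sum.cong) (use y small[OF y(1)] in \<open>force simp: min_def\<close>)+
    then have "(\<Sum>i\<in>{0..n} - C. min (g i) r) = (n + 1 - c) * r"
      by (simp add: card)
    moreover have "min (g y) r \<le> (\<Sum>i\<in>C. min (g i) r)"
      using y fin by (intro member_le_sum) auto
    moreover have "r * (n + 2 - c) = (n + 1 - c) * r + r"
      using c by (simp add: Suc_diff_le algebra_simps)
    ultimately show ?thesis using split y by simp
  next
    case False
    then have "(\<Sum>i\<in>C. min (g i) r) = (\<Sum>i\<in>C. g i)"
      by (intro sum.cong) auto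
    moreover have "(\<Sum>i\<in>{0..n} - C. k) \<le> (\<Sum>i\<in>{0..n} - C. min (g i) r)"
    proof (rule sum_mono)
      fix i assume "i \<in> {0..n} - C"
      then have "k \<le> g i" using small[OF x(1)] x(2) by fastforce
      \<comment> \<open>In this case \<open>g x < r\<close>, while \<open>k \<le> g x\<close>, so
        truncation at \<open>r\<close> preserves the bound \<open>k\<close>.\<close>
      moreover have "k \<le> r" using False x by fastforce
      ultimately show "k \<le> min (g i) r" by simp
    qed
    ultimately show ?thesis using split m r by (simp add: card)
  qed
qed

section \<open>The numerical criterion for the containment\<close>

theorem theoremA:
  fixes n c m r :: nat and k p :: int
  assumes "n \<ge> 1" and "c \<in> {1..n}" and "m \<ge> 1" and "r \<ge> 1"
    and "int m = k * int c - p" and "0 \<le> p" and "p < int c"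
  shows "symbolic_power n (star_ideal n c :: 'k::field mpoly set) m
           \<subseteq> ideal_power (poly_ring n) (star_ideal n c) r
         \<longleftrightarrow> real r \<le> real_of_int ((int n + 1) * k - p) / real_of_int (int n - int c + 2)"
proof -
  let ?R = "poly_ring n :: 'k mpoly ring"
  let ?I = "star_ideal n c :: 'k mpoly set"
  have c: "1 \<le> c" "c \<le> n" using assms by auto
  have "0 < k * int c" using assms by linarith
  then have "0 < k" using c by (simp add: zero_less_mult_iff)
  then obtain k' where k': "k = int k'" "1 \<le> k'"
    using zero_less_imp_eq_int[of k] by (metis One_nat_def Suc_leI)
  obtain q where q: "p = int q" "q < c"
    using assms by (metis int_nat_eq nat_less_iff of_nat_less_iff)
  have "int (m + q) = int (c * k')"
    using assms k' q by (simp add: mult.commute)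
  then have mq: "m + q = c * k'" by (simp only: of_nat_eq_iff)
  \<comment> \<open>Splitting \<open>n + 1\<close> into \<open>c\<close> and
    \<open>n + 1 - c\<close> turns the numerator (n+1)k - p into
    \<open>m + (n + 1 - c) * k'\<close>, a natural number without truncated subtraction at the outer
    level.\<close>
  have nk: "(n + 1) * k' = m + q + (n + 1 - c) * k'"
  proof -
    have "(n + 1) * k' = (c + (n + 1 - c)) * k'" using c by simp
    then show ?thesis by (simp add: mq add_mult_distrib)
  qed
  have X: "(int n + 1) * k - p = int (m + (n + 1 - c) * k')"
  proof -
    have "(int n + 1) * k - p = int ((n + 1) * k') - int q" by (simp add: k' q algebra_simps)
    then show ?thesis unfolding nk by simp
  qed
  have d: "int n - int c + 2 = int (n + 2 - c)" using c by simp
  have "real r \<le> real_of_int ((int n + 1) * k - p) / real_of_int (int n - int c + 2) \<longleftrightarrow>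
      real (r * (n + 2 - c)) \<le> real (m + (n + 1 - c) * k')"
    unfolding X d using c by (simp add: pos_le_divide_eq del: of_nat_diff)
  then have rhs: "real r \<le> real_of_int ((int n + 1) * k - p) / real_of_int (int n - int c + 2) \<longleftrightarrow>
      r * (n + 2 - c) \<le> m + (n + 1 - c) * k'"
    by (simp only: of_nat_le_iff)
  show ?thesis
    unfolding rhs
  proof
    assume sub: "symbolic_power n ?I m \<subseteq> ideal_power ?R ?I r"
    \<comment> \<open>The indices below \<open>q\<close> are the lowered ones; \<open>k' - 1\<close>
      is a true difference because \<open>1 \<le> k'\<close>.\<close>
    define t where "t = exp_vec {0..n} (\<lambda>i. if i < q then k' - 1 else k')"
    have lt: "Poly_Mapping.lookup t i + (if i < q then 1 else 0) = k'" if "i \<in> {0..n}" for i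
      using that k' by (simp add: t_def lookup_exp_vec)
    have deg: "part_deg C t + card (C \<inter> {..<q}) = card C * k'" if C: "C \<subseteq> {0..n}" for C
    proof -
      have fin: "finite C" using C finite_subset by blast
      have "part_deg C t + card (C \<inter> {..<q}) = (\<Sum>i\<in>C. Poly_Mapping.lookup t i + (if i < q then 1 else 0))"
        using fin by (simp add: part_deg_def sum.distrib sum.If_cases lessThan_def)
      also have "\<dots> = (\<Sum>i\<in>C. k')" using C lt by (intro sum.cong refl) blast
      finally show ?thesis by simp
    qed
    have "Poly_Mapping.single t 1 \<in> symbolic_power n ?I m"
    proof (rule monomial_in_symbolic_power[OF c])
      show "Poly_Mapping.keys t \<subseteq> {0..n}" by (auto simp: t_def keys_exp_vec)
      fix C assume C: "C \<subseteq> {0..n}" "card C = c"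
      \<comment> \<open>At most \<open>q\<close> exponents in \<open>C\<close> are lowered, and
        \<open>c * k' - q\<close> is \<open>m\<close>.\<close>
      have "card (C \<inter> {..<q}) \<le> q"
        using card_mono[of "{..<q}" "C \<inter> {..<q}"] by simp
      then show "m \<le> part_deg C t" using deg[OF C(1)] C(2) mq by simp
    qed
    then have "Poly_Mapping.single t 1 \<in> ideal_power ?R ?I r" using sub by blast
    then have "r * (n + 2 - c) \<le> part_deg {0..n} t"
      by (rule ideal_power_part_deg_ge[rotated]) (simp, rule star_ideal_part_deg[OF c(2)])
    \<comment> \<open>From \<open>q < c\<close> and \<open>c \<le> n\<close>, all \<open>q\<close>
      lowered indices occur, so the degree of x^t is exactly
      \<open>(n + 1) * k' - q\<close>.\<close>
    moreover have "{0..n} \<inter> {..<q} = {..<q}" using q c by auto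
    then have "part_deg {0..n} t + q = (n + 1) * k'" using deg[of "{0..n}"] by simp
    ultimately show "r * (n + 2 - c) \<le> m + (n + 1 - c) * k'" using nk by simp
  next
    assume r: "r * (n + 2 - c) \<le> m + (n + 1 - c) * k'"
    interpret cring ?R by (rule poly_ring_cring)
    show "symbolic_power n ?I m \<subseteq> ideal_power ?R ?I r"
    proof
      fix f assume f: "f \<in> symbolic_power n ?I m"
      then have fR: "f \<in> carrier ?R" by (simp add: symbolic_power_def)
      show "f \<in> ideal_power ?R ?I r"
      proof (rule ideal_memI_monomials[OF ideal_ideal_power[OF ideal_star_ideal[OF c(2)]] fR])
        fix t assume t: "t \<in> Poly_Mapping.keys f"
        show "Poly_Mapping.single t 1 \<in> ideal_power ?R ?I r"
        proof (rule monomial_in_star_ideal_power[OF c(2)])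
          show "Poly_Mapping.keys t \<subseteq> {0..n}" using fR t by (auto simp: carrier_poly_ring)
          show "r * (n + 2 - c) \<le> (\<Sum>i\<in>{0..n}. min (Poly_Mapping.lookup t i) r)"
          proof (rule sum_min_ge[OF c _ _ r])
            show "m \<le> (\<Sum>i\<in>C. Poly_Mapping.lookup t i)" if "C \<subseteq> {0..n}" "card C = c" for C
              using symbolic_power_part_deg[OF c that f t] by (simp add: part_deg_def)
            show "c * k' < m + c" using mq q by simp
          qed
        qed
      qed
    qed
  qed
qed

end
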